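(* Fix positive integers $k$, $m\le k$, and $d$, and let $q=p^{\ell}$ where $p\ge k$ is prime. Set \[\gamma=\Big(\sum_{l=1}^m \frac1l\binom{k-1}{l-1}S(m,l)\Big)\cdot d\cdot(q-1).\] Then there is a constant $C$ depending only on $k,m,d,q$ such that the following holds for every $n\ge1$: if $\mathcal{P}$ is a property of $k$-tuples of elements of $\mathbb{F}_q^n$ having an identifier $g:(\mathbb{F}_q^n)^m\to\mathbb{F}_q$ of degree $d$, and $A\subseteq\mathbb{F}_q^n$ is such that no $k$-tuple of pairwise distinct elements of $A$ satisfies $\mathcal{P}$, then $|A|\le C n^{\gamma}$ (i.e. $|A|=O(n^\gamma)$).
   Context: $S(m,l)$ is the number of partitions of $\{1,\ldots,m\}$ into exactly $l$ blocks. A function $g:(\mathbb{F}_q^n)^m\to\mathbb{F}_q$ is an identifier of $\mathcal{P}$ if (1) $g$ is given by a polynomial in the $mn$ coordinates of its input (its degree $\deg g$ is the total degree of this polynomial); (2) $\vec{x}_1,\ldots,\vec{x}_k\in\mathbb{F}_q^n$ satisfy $\mathcal{P}$ if and only if $g(\vec{x}_{i_1},\ldots,\vec{x}_{i_m})=0$ for all $1\le i_1<\cdots<i_m\le k$; (3) $g(\vec{x},\ldots,\vec{x})=0$ for every $\vec{x}\in\mathbb{F}_q^n$. *)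

theory Defs
  imports
    Complex_Main
    "HOL-Library.Poly_Mapping"
    "HOL-Library.Disjoint_Sets"
    "HOL-Computational_Algebra.Primes"
    "Jordan_Normal_Form.Matrix"
begin

definition stirling2 :: "nat \<Rightarrow> nat \<Rightarrow> nat" where
  "stirling2 m l = card {B. partition_on {1..m} B \<and> card B = l}"

text \<open>Multivariate polynomials are finitely supported maps from monomials to coefficients, a
  monomial being a finitely supported map from variables to exponents.\<close>

type_synonym ('v, 'a) mpoly = "('v \<Rightarrow>\<^sub>0 nat) \<Rightarrow>\<^sub>0 'a"

definition mpoly_vars :: "('v, 'a::zero) mpoly \<Rightarrow> 'v set" where
  "mpoly_vars Q = (\<Union>t\<in>Poly_Mapping.keys Q. Poly_Mapping.keys t)"

definition mpoly_eval :: "('v, 'a::comm_semiring_1) mpoly \<Rightarrow> ('v \<Rightarrow> 'a) \<Rightarrow> 'a" where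
  "mpoly_eval Q a =
     (\<Sum>t\<in>Poly_Mapping.keys Q. Poly_Mapping.lookup Q t *
        (\<Prod>v\<in>Poly_Mapping.keys t. a v ^ Poly_Mapping.lookup t v))"

text \<open>The zero polynomial gets degree 0.\<close>

definition total_degree :: "('v, 'a::zero) mpoly \<Rightarrow> nat" where
  "total_degree Q =
     Max (insert 0 ((\<lambda>t. \<Sum>v\<in>Poly_Mapping.keys t. Poly_Mapping.lookup t v) ` Poly_Mapping.keys Q))"

definition vec_tuples :: "nat \<Rightarrow> nat \<Rightarrow> 'a vec list set" where
  "vec_tuples m n = {xs. length xs = m \<and> set xs \<subseteq> carrier_vec n}"

text \<open>The polynomial \<open>Q\<close> giving \<open>g\<close> is a parameter because the degree of an identifier is that of
  the polynomial, which the function does not determine. Its variable \<open>(i, j)\<close> stands for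
  coordinate \<open>j\<close> of the \<open>i\<close>-th argument. All positions and coordinates are counted from 0.\<close>

definition is_identifier ::
    "nat \<Rightarrow> nat \<Rightarrow> nat \<Rightarrow> ('a::field vec list \<Rightarrow> bool) \<Rightarrow> ('a vec list \<Rightarrow> 'a) \<Rightarrow> (nat \<times> nat, 'a) mpoly \<Rightarrow> bool"
  where
  "is_identifier k m n P g Q \<longleftrightarrow>
     mpoly_vars Q \<subseteq> {..<m} \<times> {..<n} \<and>
     (\<forall>xs \<in> vec_tuples m n. g xs = mpoly_eval Q (\<lambda>(i, j). (xs ! i) $ j)) \<and>
     (\<forall>xs \<in> vec_tuples k n.
        P xs \<longleftrightarrow>
        (\<forall>js. length js = m \<and> sorted_wrt (<) js \<and> set js \<subseteq> {..<k} \<longrightarrow> g (map (\<lambda>i. xs ! i) js) = 0)) \<and>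
     (\<forall>x \<in> carrier_vec n. g (replicate m x) = 0)"

end

theory Submission
  imports Defs "HOL-Library.FuncSet"
begin

text \<open>
  If \<open>A\<close> has more than \<open>k\<close> times as many points as there are monomials of degree at most
  \<open>t = \<lfloor>\<gamma>\<rfloor>\<close>, then there are a point \<open>a \<in> A\<close> and functions \<open>h\<^sub>0, \<dots>, h\<^sub>k\<^sub>-\<^sub>1\<close> on \<open>A\<close>, each orthogonal
  to all these monomials and with value 1 at \<open>a\<close>, whose supports meet pairwise only in \<open>a\<close>.
  Let \<open>F(x) = \<Prod> (1 - g(x\<^sub>i\<^sub>1, \<dots>, x\<^sub>i\<^sub>m)\<^sup>q\<^sup>-\<^sup>1)\<close> be the indicator of the property. If no distinct tuple
  has it, the sum of \<open>F(x) \<Prod>\<^sub>i (h\<^sub>i - \<delta>\<^sub>a)(x\<^sub>i)\<close> over \<open>x \<in> A\<^sup>k\<close> vanishes. Expanding the product over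
  the set \<open>J\<close> of indices at which \<open>h\<^sub>i\<close> is chosen, the term \<open>J = \<emptyset>\<close> is \<open>\<plusminus>F(a, \<dots>, a) = \<plusminus>1\<close>. In every
  other term the coordinates outside \<open>J\<close> are frozen to \<open>a\<close>, many of the 0-1-valued factors of
  \<open>F\<close> coincide, and what remains has degree less than \<open>|J|(t + 1)\<close>, so each of its monomials has
  degree at most \<open>t\<close> in some \<open>x\<^sub>i\<close> with \<open>i \<in> J\<close> and is killed by \<open>h\<^sub>i\<close>: a contradiction. The degree
  bound comes from \<open>S(m, l) \<ge> (m choose l)\<close> for \<open>l \<ge> 2\<close>, where \<open>(m choose l)\<close> counts the ways to place
  the \<open>l\<close> coordinates that are not frozen among the \<open>m\<close> arguments of \<open>g\<close>.
\<close>

subsection \<open>Functions orthogonal to a small family\<close>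

text \<open>The vectors of values \<open>(\<phi> x)\<close> at the points of \<open>B'\<close> span
  those at all points of \<open>B\<close>, and \<open>h\<close> records the relation for
  \<open>b\<close>. As in Gaussian elimination, each function of \<open>\<Phi>\<close> adds at most
  one pivot point to \<open>B'\<close>.\<close>

lemma exists_small_spanning_subset:
  fixes \<Phi> :: "('b \<Rightarrow> 'a::field) set"
  assumes "finite \<Phi>" "finite B"
  shows "\<exists>B' \<subseteq> B. card B' \<le> card \<Phi> \<and>
    (\<forall>b\<in>B - B'. \<exists>h. h b = 1 \<and> (\<forall>x. h x \<noteq> 0 \<longrightarrow> x \<in> insert b B') \<and>
       (\<forall>\<phi>\<in>\<Phi>. (\<Sum>x\<in>B. h x * \<phi> x) = 0))"
  using assms(1)
proof (induction \<Phi>)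
  case empty
  show ?case
    by (rule exI[of _ "{}"]) (auto intro!: exI[of _ "\<lambda>x. if x = _ then 1 else 0"] split: if_splits)
next
  case (insert \<psi> \<Phi>)
  then obtain B' where B': "B' \<subseteq> B" "card B' \<le> card \<Phi>"
    and "\<forall>b\<in>B - B'. \<exists>h. h b = 1 \<and> (\<forall>x. h x \<noteq> 0 \<longrightarrow> x \<in> insert b B') \<and>
       (\<forall>\<phi>\<in>\<Phi>. (\<Sum>x\<in>B. h x * \<phi> x) = 0)" by blast
  then obtain H where H: "\<And>b. b \<in> B - B' \<Longrightarrow> H b b = 1"
    "\<And>b x. b \<in> B - B' \<Longrightarrow> H b x \<noteq> 0 \<Longrightarrow> x \<in> insert b B'"
    "\<And>b \<phi>. b \<in> B - B' \<Longrightarrow> \<phi> \<in> \<Phi> \<Longrightarrow> (\<Sum>x\<in>B. H b x * \<phi> x) = 0"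
    by metis
  define s where "s b = (\<Sum>x\<in>B. H b x * \<psi> x)" for b
  show ?case
  proof (cases "\<forall>b\<in>B - B'. s b = 0")
    case True
    show ?thesis
    proof (intro exI[of _ B'] conjI ballI)
      fix b assume "b \<in> B - B'"
      then show "\<exists>h. h b = 1 \<and> (\<forall>x. h x \<noteq> 0 \<longrightarrow> x \<in> insert b B') \<and>
         (\<forall>\<phi>\<in>insert \<psi> \<Phi>. (\<Sum>x\<in>B. h x * \<phi> x) = 0)"
        using True H unfolding s_def by (intro exI[of _ "H b"]) blast
    qed (use B' insert.hyps in auto)
  next
    case False
    then obtain c where c: "c \<in> B - B'" "s c \<noteq> 0" by blast
    show ?thesis
    proof (intro exI[of _ "insert c B'"] conjI ballI)
      have "finite B'" using B' assms(2) finite_subset by blast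
      then show "card (insert c B') \<le> card (insert \<psi> \<Phi>)"
        using B' insert.hyps c by (simp add: card_insert_if)
    next
      fix b assume b: "b \<in> B - insert c B'"
      \<comment> \<open>This multiple of the pivot relation cancels the sum against
        \<open>\<psi>\<close>; the value at \<open>b\<close> stays 1 because \<open>H c\<close>
        vanishes there.\<close>
      define h where "h x = H b x - s b / s c * H c x" for x
      have "h b = 1"
        using H(1)[of b] H(2)[of c b] b c by (auto simp: h_def)
      moreover have "x \<in> insert b (insert c B')" if "h x \<noteq> 0" for x
      proof -
        have "H b x \<noteq> 0 \<or> H c x \<noteq> 0" using that by (auto simp: h_def)
        then show ?thesis using H(2)[of b x] H(2)[of c x] b c by auto
      qed
      moreover have "(\<Sum>x\<in>B. h x * \<phi> x) = 0" if "\<phi> \<in> insert \<psi> \<Phi>" for \<phi>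
      proof -
        have "(\<Sum>x\<in>B. h x * \<phi> x) =
            (\<Sum>x\<in>B. H b x * \<phi> x) - s b / s c * (\<Sum>x\<in>B. H c x * \<phi> x)"
          by (simp add: h_def left_diff_distrib sum_subtractf sum_distrib_left mult.assoc)
        also have "\<dots> = 0"
        proof (cases "\<phi> = \<psi>")
          case True
          then show ?thesis using c by (simp flip: s_def)
        next
          case False
          then show ?thesis using that H(3) b c by auto
        qed
        finally show ?thesis .
      qed
      ultimately show "\<exists>h. h b = 1 \<and> (\<forall>x. h x \<noteq> 0 \<longrightarrow> x \<in> insert b (insert c B')) \<and>
         (\<forall>\<phi>\<in>insert \<psi> \<Phi>. (\<Sum>x\<in>B. h x * \<phi> x) = 0)"
        by blast
    qed (use B' c in auto)
  qed
qed

text \<open>Each step peels a spanning subset \<open>B\<close> of at most \<open>card \<Phi>\<close>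
  points off \<open>A\<close>; some \<open>a\<close> survives all \<open>k\<close> steps. The
  function of a step lives on \<open>B\<close> and \<open>a\<close>, all later ones on
  \<open>A - B\<close>.\<close>

lemma exists_orthogonal_functions_meeting_in_point:
  fixes \<Phi> :: "('b \<Rightarrow> 'a::field) set"
  assumes "finite \<Phi>" "finite A" "k * card \<Phi> < card A"
  shows "\<exists>a\<in>A. \<exists>h :: nat \<Rightarrow> 'b \<Rightarrow> 'a.
    (\<forall>i<k. h i a = 1 \<and> (\<forall>x. h i x \<noteq> 0 \<longrightarrow> x \<in> A) \<and> (\<forall>\<phi>\<in>\<Phi>. (\<Sum>x\<in>A. h i x * \<phi> x) = 0)) \<and>
    (\<forall>i<k. \<forall>j<k. \<forall>x. i \<noteq> j \<and> h i x \<noteq> 0 \<and> h j x \<noteq> 0 \<longrightarrow> x = a)"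
  using assms(2,3)
proof (induction k arbitrary: A)
  case 0
  then have "A \<noteq> {}" by auto
  then show ?case by auto
next
  case (Suc k)
  from exists_small_spanning_subset[OF assms(1) Suc.prems(1)]
  obtain B where B: "B \<subseteq> A" "card B \<le> card \<Phi>"
    and H: "\<forall>b\<in>A - B. \<exists>h. h b = 1 \<and> (\<forall>x. h x \<noteq> 0 \<longrightarrow> x \<in> insert b B) \<and>
       (\<forall>\<phi>\<in>\<Phi>. (\<Sum>x\<in>A. h x * \<phi> x) = 0)"
    by (elim exE conjE)
  have "finite B" using B Suc.prems finite_subset by blast
  then have "k * card \<Phi> < card (A - B)"
    using Suc.prems B by (simp add: card_Diff_subset)
  from Suc.IH[OF finite_Diff[OF Suc.prems(1)] this]
  obtain a h where a: "a \<in> A - B"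
    and h: "\<forall>i<k. h i a = 1 \<and> (\<forall>x. h i x \<noteq> 0 \<longrightarrow> x \<in> A - B) \<and>
      (\<forall>\<phi>\<in>\<Phi>. (\<Sum>x\<in>A - B. h i x * \<phi> x) = 0)"
    and h4: "\<forall>i<k. \<forall>j<k. \<forall>x. i \<noteq> j \<and> h i x \<noteq> 0 \<and> h j x \<noteq> 0 \<longrightarrow> x = a"
    by (elim bexE exE conjE)
  have h1: "h i a = 1" if "i < k" for i
    using h that by simp
  have h2: "x \<in> A - B" if "i < k" "h i x \<noteq> 0" for i x
    using h that by simp
  have h3: "(\<Sum>x\<in>A - B. h i x * \<phi> x) = 0" if "i < k" "\<phi> \<in> \<Phi>" for i \<phi>
    using h that by simp
  obtain g where g: "g a = 1" "\<And>x. g x \<noteq> 0 \<Longrightarrow> x \<in> insert a B"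
    "\<And>\<phi>. \<phi> \<in> \<Phi> \<Longrightarrow> (\<Sum>x\<in>A. g x * \<phi> x) = 0"
    using bspec[OF H a] by (elim exE conjE) simp
  have h3': "(\<Sum>x\<in>A. h i x * \<phi> x) = 0" if "i < k" "\<phi> \<in> \<Phi>" for i \<phi>
  proof -
    have "(\<Sum>x\<in>A. h i x * \<phi> x) = (\<Sum>x\<in>A - B. h i x * \<phi> x)"
      by (rule sum.mono_neutral_right) (use Suc.prems h2[OF that(1)] in auto)
    then show ?thesis using h3 that by simp
  qed
  define h' where "h' i = (if i = k then g else h i)" for i
  show ?case
  proof (intro bexI[of _ a] exI[of _ h'] conjI allI impI ballI)
    fix i assume "i < Suc k"
    then show "h' i a = 1" using g h1 by (auto simp: h'_def less_Suc_eq)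
  next
    fix i x assume "i < Suc k" "h' i x \<noteq> 0"
    then show "x \<in> A" using g(2)[of x] h2[of i x] a B by (auto simp: h'_def less_Suc_eq split: if_splits)
  next
    fix i \<phi> assume "i < Suc k" "\<phi> \<in> \<Phi>"
    then show "(\<Sum>x\<in>A. h' i x * \<phi> x) = 0" using g h3' by (auto simp: h'_def less_Suc_eq)
  next
    fix i j x assume ij: "i < Suc k" "j < Suc k" "i \<noteq> j \<and> h' i x \<noteq> 0 \<and> h' j x \<noteq> 0"
    consider "i < k" "j < k" | "i = k" "j < k" | "i < k" "j = k" using ij by linarith
    then show "x = a"
      using ij h4[rule_format, of i j x] h2[of i x] h2[of j x] g(2)[of x]
      by cases (auto simp: h'_def)
  qed (use a in auto)
qed

subsection \<open>Polynomial functions of bounded degree\<close>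

text \<open>Functions rather than formal polynomials are bounded in degree; with monomials as lists
  of variables, multiplication is concatenation.\<close>

inductive poly_fun_le :: "'v set \<Rightarrow> nat \<Rightarrow> (('v \<Rightarrow> 'a::comm_ring_1) \<Rightarrow> 'a) \<Rightarrow> bool"
  for V :: "'v set" and D :: nat
  where
    monom: "set vs \<subseteq> V \<Longrightarrow> length vs \<le> D \<Longrightarrow> poly_fun_le V D (\<lambda>x. c * (\<Prod>v\<leftarrow>vs. x v))"
  | add: "poly_fun_le V D f \<Longrightarrow> poly_fun_le V D g \<Longrightarrow> poly_fun_le V D (\<lambda>x. f x + g x)"

lemma poly_fun_le_const: "poly_fun_le V D (\<lambda>x. c)"
  using poly_fun_le.monom[of "[]" V D c] by simp

lemma poly_fun_le_var: "v \<in> V \<Longrightarrow> 0 < D \<Longrightarrow> poly_fun_le V D (\<lambda>x. x v)"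
  using poly_fun_le.monom[of "[v]" V D 1] by simp

lemma poly_fun_le_mono: "poly_fun_le V D f \<Longrightarrow> D \<le> E \<Longrightarrow> poly_fun_le V E f"
  by (induction rule: poly_fun_le.induct) (auto intro: poly_fun_le.intros)

lemma poly_fun_le_mult:
  assumes "poly_fun_le V D f" "poly_fun_le V E g"
  shows "poly_fun_le V (D + E) (\<lambda>x. f x * g x)"
  using assms(1)
proof induction
  case (monom vs c)
  show ?case using assms(2)
  proof induction
    case (monom us b)
    with \<open>set vs \<subseteq> V\<close> \<open>length vs \<le> D\<close> show ?case
      using poly_fun_le.monom[of "vs @ us" V "D + E" "c * b"] by (simp add: mult_ac)
  qed (auto simp: distrib_left intro: poly_fun_le.add)
qed (auto simp: distrib_right intro: poly_fun_le.add)

lemma poly_fun_le_one_minus: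
  assumes "poly_fun_le V D f"
  shows "poly_fun_le V D (\<lambda>x. 1 - f x)"
  using poly_fun_le.add[OF poly_fun_le_const[of V D 1]
      poly_fun_le_mult[OF poly_fun_le_const[of V 0 "- 1"] assms, simplified]]
  by simp

lemma poly_fun_le_power: "poly_fun_le V D f \<Longrightarrow> poly_fun_le V (N * D) (\<lambda>x. f x ^ N)"
  by (induction N) (auto intro: poly_fun_le_const poly_fun_le_mult)

lemma poly_fun_le_sum:
  "(\<And>i. i \<in> S \<Longrightarrow> poly_fun_le V D (f i)) \<Longrightarrow> poly_fun_le V D (\<lambda>x. \<Sum>i\<in>S. f i x)"
  by (induction S rule: infinite_finite_induct)
     (auto intro: poly_fun_le_const poly_fun_le.add)

lemma poly_fun_le_prod:
  "(\<And>i. i \<in> S \<Longrightarrow> poly_fun_le V (D i) (f i)) \<Longrightarrow>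
    poly_fun_le V (\<Sum>i\<in>S. D i) (\<lambda>x. \<Prod>i\<in>S. f i x)"
  by (induction S rule: infinite_finite_induct)
     (auto intro: poly_fun_le_const poly_fun_le_mult)

text \<open>Serves to freeze arguments of a polynomial: some variables are kept and the others
  become constants.\<close>

lemma poly_fun_le_mpoly_eval:
  fixes Q :: "('w, 'a::comm_ring_1) mpoly"
  assumes "\<And>v. v \<in> mpoly_vars Q \<Longrightarrow> poly_fun_le V 1 (\<sigma> v)"
  shows "poly_fun_le V (total_degree Q) (\<lambda>x. mpoly_eval Q (\<lambda>v. \<sigma> v x))"
  unfolding mpoly_eval_def
proof (rule poly_fun_le_sum)
  fix t assume t: "t \<in> Poly_Mapping.keys Q"
  have "poly_fun_le V (\<Sum>v\<in>Poly_Mapping.keys t. Poly_Mapping.lookup t v * 1)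
      (\<lambda>x. \<Prod>v\<in>Poly_Mapping.keys t. \<sigma> v x ^ Poly_Mapping.lookup t v)"
    using t by (intro poly_fun_le_prod poly_fun_le_power assms) (auto simp: mpoly_vars_def)
  moreover have "(\<Sum>v\<in>Poly_Mapping.keys t. Poly_Mapping.lookup t v * 1) \<le> total_degree Q"
    using t by (auto simp: total_degree_def intro!: Max_ge)
  ultimately have "poly_fun_le V (total_degree Q)
      (\<lambda>x. \<Prod>v\<in>Poly_Mapping.keys t. \<sigma> v x ^ Poly_Mapping.lookup t v)"
    by (rule poly_fun_le_mono)
  from poly_fun_le_mult[OF poly_fun_le_const[of V 0] this]
  show "poly_fun_le V (total_degree Q) (\<lambda>x. Poly_Mapping.lookup Q t *
      (\<Prod>v\<in>Poly_Mapping.keys t. \<sigma> v x ^ Poly_Mapping.lookup t v))" by simp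
qed

lemma mpoly_eval_cong:
  "(\<And>v. v \<in> mpoly_vars Q \<Longrightarrow> a v = b v) \<Longrightarrow> mpoly_eval Q a = mpoly_eval Q b"
  unfolding mpoly_eval_def mpoly_vars_def
  by (intro sum.cong prod.cong arg_cong2[of _ _ _ _ "(*)"] arg_cong2[of _ _ _ _ "(^)"]) auto

section \<open>Sums over tuples weighted by orthogonal functions\<close>

lemma prod_list_split_by_fst:
  fixes f :: "'i \<times> 'l \<Rightarrow> 'a::comm_monoid_mult"
  assumes "finite I" "fst ` set vs \<subseteq> I"
  shows "(\<Prod>v\<leftarrow>vs. f v) = (\<Prod>i\<in>I. \<Prod>l\<leftarrow>map snd (filter (\<lambda>v. fst v = i) vs). f (i, l))"
  using assms(2)
proof (induction vs)
  case (Cons v vs)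
  have "(\<Prod>i\<in>I. \<Prod>l\<leftarrow>map snd (filter (\<lambda>u. fst u = i) (v # vs)). f (i, l)) =
    (\<Prod>i\<in>I. (if i = fst v then f v else 1) * (\<Prod>l\<leftarrow>map snd (filter (\<lambda>u. fst u = i) vs). f (i, l)))"
    by (intro prod.cong) auto
  also have "\<dots> = f v * (\<Prod>i\<in>I. \<Prod>l\<leftarrow>map snd (filter (\<lambda>u. fst u = i) vs). f (i, l))"
    using Cons.prems assms(1) by (simp add: prod.distrib prod.delta)
  finally show ?case using Cons by simp
qed simp

lemma sum_length_filter_fst:
  assumes "finite I" "fst ` set vs \<subseteq> I"
  shows "(\<Sum>i\<in>I. length (filter (\<lambda>v. fst v = i) vs)) = length vs"
  using assms(2)
proof (induction vs)
  case (Cons v vs)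
  have "(\<Sum>i\<in>I. length (filter (\<lambda>u. fst u = i) (v # vs))) =
    (\<Sum>i\<in>I. (if i = fst v then 1 else 0) + length (filter (\<lambda>u. fst u = i) vs))"
    by (intro sum.cong) auto
  then show ?case using Cons assms(1) by (simp add: sum.distrib)
qed simp

text \<open>Pigeonhole: a monomial of degree below \<open>card J * (t + 1)\<close> has degree at
  most \<open>t\<close> in the variables of some \<open>i \<in> J\<close>. The sum over tuples
  factors over \<open>I\<close>, and the factor of that index is 0 by \<open>orth\<close>.\<close>

lemma sum_PiE_poly_fun_eq_0:
  fixes u :: "'i \<Rightarrow> 'b \<Rightarrow> 'a::comm_ring_1" and \<xi> :: "'b \<Rightarrow> 'l \<Rightarrow> 'a"
  assumes I: "finite I" "J \<subseteq> I" and A: "finite A"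
    and orth: "\<And>i ls. i \<in> J \<Longrightarrow> set ls \<subseteq> L \<Longrightarrow> length ls \<le> t \<Longrightarrow>
        (\<Sum>y\<in>A. u i y * (\<Prod>l\<leftarrow>ls. \<xi> y l)) = 0"
    and f: "poly_fun_le (J \<times> L) D f" and D: "D < card J * (t + 1)"
  shows "(\<Sum>x\<in>PiE I (\<lambda>_. A). f (\<lambda>v. \<xi> (x (fst v)) (snd v)) * (\<Prod>i\<in>I. u i (x i))) = 0"
  using f
proof induction
  case (monom vs c)
  define w where "w i = map snd (filter (\<lambda>v. fst v = i) vs)" for i
  have vs: "fst ` set vs \<subseteq> J" using monom by auto
  have "\<exists>i\<in>J. length (w i) \<le> t"
  proof (rule ccontr)
    assume "\<not> ?thesis"
    then have "card J * (t + 1) \<le> (\<Sum>i\<in>J. length (w i))"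
      by (intro sum_bounded_below[of J "t + 1", simplified of_nat_id]) auto
    also have "\<dots> = length vs"
      unfolding w_def length_map by (rule sum_length_filter_fst[OF finite_subset[OF I(2,1)] vs])
    finally show False using monom D by linarith
  qed
  then obtain i0 where i0: "i0 \<in> J" "length (w i0) \<le> t" by blast
  have "set (w i0) \<subseteq> L" using monom by (auto simp: w_def)
  then have zero: "(\<Sum>y\<in>A. u i0 y * (\<Prod>l\<leftarrow>w i0. \<xi> y l)) = 0" using orth i0 by blast
  have "(\<Sum>x\<in>PiE I (\<lambda>_. A). c * (\<Prod>v\<leftarrow>vs. \<xi> (x (fst v)) (snd v)) * (\<Prod>i\<in>I. u i (x i))) =
      c * (\<Sum>x\<in>PiE I (\<lambda>_. A). \<Prod>i\<in>I. u i (x i) * (\<Prod>l\<leftarrow>w i. \<xi> (x i) l))"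
    using vs I by (simp add: sum_distrib_left w_def prod.distrib mult_ac
      prod_list_split_by_fst[of I vs])
  also have "(\<Sum>x\<in>PiE I (\<lambda>_. A). \<Prod>i\<in>I. u i (x i) * (\<Prod>l\<leftarrow>w i. \<xi> (x i) l)) =
      (\<Prod>i\<in>I. \<Sum>y\<in>A. u i y * (\<Prod>l\<leftarrow>w i. \<xi> y l))"
    using I A by (intro prod_sum_PiE[symmetric]) auto
  also have "\<dots> = 0" using I i0 zero by (intro prod_zero) auto
  finally show ?case by simp
qed (simp add: distrib_right sum.distrib)

lemma sum_powers_le: "(\<Sum>i\<le>t. n ^ i) \<le> (n + 1) ^ t" for n :: nat
proof (induction t)
  case (Suc t)
  have "n ^ t \<le> (n + 1) ^ t" by (rule power_mono) auto
  then have "n ^ Suc t \<le> n * (n + 1) ^ t" unfolding power_Suc by (rule mult_left_mono) simp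
  then have "(\<Sum>i\<le>t. n ^ i) + n ^ Suc t \<le> (n + 1) ^ t + n * (n + 1) ^ t" using Suc by (rule add_mono[rotated])
  then show ?case by simp
qed simp

lemma card_monomials_le:
  "finite ((\<lambda>ls y. \<Prod>l\<leftarrow>ls. \<xi> y l) ` {ls. set ls \<subseteq> {..<n::nat} \<and> length ls \<le> t})"
  "card ((\<lambda>ls y. \<Prod>l\<leftarrow>ls. \<xi> y l) ` {ls. set ls \<subseteq> {..<n::nat} \<and> length ls \<le> t}) \<le> (n + 1) ^ t"
proof -
  have fin: "finite {ls. set ls \<subseteq> {..<n} \<and> length ls \<le> t}" by (rule finite_lists_length_le) simp
  then show "finite ((\<lambda>ls y. \<Prod>l\<leftarrow>ls. \<xi> y l) ` {ls. set ls \<subseteq> {..<n::nat} \<and> length ls \<le> t})" by simp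
  have "card {ls. set ls \<subseteq> {..<n} \<and> length ls \<le> t} \<le> (n + 1) ^ t"
    using sum_powers_le[where t = t and n = n] card_lists_length_le[of "{..<n}" t] by simp
  then show "card ((\<lambda>ls y. \<Prod>l\<leftarrow>ls. \<xi> y l) ` {ls. set ls \<subseteq> {..<n::nat} \<and> length ls \<le> t}) \<le> (n + 1) ^ t"
    using card_image_le[OF fin] le_trans by blast
qed

subsection \<open>Lower bounds for Stirling numbers\<close>

lemma finite_partitions: "finite {B. partition_on {1..m} B \<and> card B = l}" for m l :: nat
  by (rule finite_subset[OF _ finitely_many_partition_on[of "{1..m}"]]) auto

lemma one_le_stirling2_1:
  assumes "0 < m"
  shows "1 \<le> stirling2 m 1"
proof -
  have "{{1..m}} \<in> {B. partition_on {1..m} B \<and> card B = 1}"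
    using assms by (simp add: partition_on_space)
  then have "card {B. partition_on {1..m} B \<and> card B = 1} \<noteq> 0"
    using finite_partitions[of m 1] by (auto simp only: card_eq_0_iff)
  then show ?thesis by (simp add: stirling2_def)
qed

lemma card_le_Suc_eq:
  fixes T :: "nat set"
  assumes "finite T"
  shows "card {t \<in> T. t \<le> Suc i} = card {t \<in> T. t \<le> i} + (if Suc i \<in> T then 1 else 0)"
proof -
  have "{t \<in> T. t \<le> Suc i} = {t \<in> T. t \<le> i} \<union> (if Suc i \<in> T then {Suc i} else {})"
    by (auto simp: le_Suc_eq)
  then show ?thesis using assms by auto
qed

text \<open>Discrete intermediate value: the count starts at 0, as \<open>0 \<notin> T\<close>, and
  grows by at most 1 per step.\<close>

lemma ex_card_le_eq:
  fixes T :: "nat set"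
  assumes "finite T" "0 \<notin> T" "r \<le> card {t \<in> T. t \<le> m}"
  shows "\<exists>i\<le>m. card {t \<in> T. t \<le> i} = r"
  using assms(3)
proof (induction m)
  case 0
  have "{t \<in> T. t \<le> 0} = {}" using assms(2) gr0I by blast
  with 0 show ?case by (metis bot_nat_0.extremum_uniqueI card.empty)
next
  case (Suc m)
  show ?case
  proof (cases "r \<le> card {t \<in> T. t \<le> m}")
    case True
    then show ?thesis using Suc.IH le_SucI by blast
  next
    case False
    then have "card {t \<in> T. t \<le> Suc m} = r"
      using Suc.prems card_le_Suc_eq[OF assms(1), of m] by (auto split: if_splits)
    then show ?thesis by blast
  qed
qed

text \<open>A set \<open>T\<close> of \<open>l \<ge> 2\<close> points cuts the cycle \<open>1, \<dots>, m, 1\<close> into \<open>l\<close> arcs, each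
  starting at a point of \<open>T\<close>; the partition into these arcs determines \<open>T\<close>.\<close>

lemma choose_le_stirling2:
  assumes "2 \<le> l"
  shows "m choose l \<le> stirling2 m l"
proof -
  \<comment> \<open>\<open>c T i\<close> names the arc of \<open>i\<close>. Reduction mod
    \<open>l\<close> joins the points before the first element of \<open>T\<close> (count 0) to
    those from its last element on (count \<open>l\<close>).\<close>
  define c where "c T i = card {t \<in> T. t \<le> i} mod l" for T and i :: nat
  define arcs where "arcs T = (\<lambda>r. {i \<in> {1..m}. c T i = r}) ` {..<l}" for T
  define \<T> where "\<T> = {T. T \<subseteq> {1..m} \<and> card T = l}"
  have "inj_on arcs \<T>"
  \<comment> \<open>The inverse recovers \<open>T\<close> as the points separated from their cyclic
    predecessor. Since \<open>2 \<le> l\<close>, a step of the count by 1 changes its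
    residue.\<close>
  proof (rule inj_on_inverseI[where g = "\<lambda>P. {i \<in> {1..m}. \<not> (\<exists>B\<in>P. i \<in> B \<and> (if i = 1 then m else i - 1) \<in> B)}"])
    fix T assume "T \<in> \<T>"
    then have T: "T \<subseteq> {1..m}" "card T = l" "finite T"
      by (auto simp: \<T>_def intro: finite_subset)
    have same: "(\<exists>B\<in>arcs T. i \<in> B \<and> j \<in> B) \<longleftrightarrow> c T i = c T j" if "i \<in> {1..m}" "j \<in> {1..m}" for i j
      using that assms by (auto simp: arcs_def c_def)
    have "\<not> (\<exists>B\<in>arcs T. i \<in> B \<and> (if i = 1 then m else i - 1) \<in> B) \<longleftrightarrow> i \<in> T"
      if i: "i \<in> {1..m}" for i
    proof (cases "i = 1")
      case True
      have "{t \<in> T. t \<le> m} = T" using T by auto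
      then have "c T m = 0" using T by (simp add: c_def)
      moreover have "{t \<in> T. t \<le> 0} = {}" using T by auto
      then have "card {t \<in> T. t \<le> 1} = (if 1 \<in> T then 1 else 0)"
        using card_le_Suc_eq[OF T(3), of 0] unfolding One_nat_def by (simp only: card.empty add_0)
      then have "c T 1 = (if 1 \<in> T then 1 else 0)"
        using assms by (simp add: c_def)
      ultimately show ?thesis using True same[of 1 m] i by auto
    next
      case False
      then obtain i' where i': "i = Suc i'" "i' \<in> {1..m}" using i by (cases i) auto
      have "c T i = c T i' \<longleftrightarrow> i \<notin> T"
        using card_le_Suc_eq[OF T(3), of i'] assms by (auto simp: c_def i' mod_Suc)
      then show ?thesis using same[of i i'] i i' False by simp
    qed
    then show "{i \<in> {1..m}. \<not> (\<exists>B\<in>arcs T. i \<in> B \<and> (if i = 1 then m else i - 1) \<in> B)} = T"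
      using T by blast
  qed
  moreover have "arcs ` \<T> \<subseteq> {B. partition_on {1..m} B \<and> card B = l}"
  proof (intro image_subsetI CollectI conjI)
    fix T assume "T \<in> \<T>"
    then have T: "T \<subseteq> {1..m}" "card T = l" "finite T"
      by (auto simp: \<T>_def intro: finite_subset)
    then have m: "{t \<in> T. t \<le> m} = T" "0 \<notin> T" by auto
    \<comment> \<open>No arc is empty: residue 0 occurs at \<open>m\<close>, the others because the
      count does not jump.\<close>
    have surj: "\<exists>i\<in>{1..m}. c T i = r" if r: "r < l" for r
    proof (cases "r = 0")
      case True
      have "T \<noteq> {}" using T assms by auto
      then have "m \<in> {1..m}" using T by force
      then show ?thesis using True T m by (intro bexI[of _ m]) (auto simp: c_def)
    next
      case False
      obtain i where i: "i \<le> m" "card {t \<in> T. t \<le> i} = r"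
        using ex_card_le_eq[of T r m] T m r by auto
      have "{t \<in> T. t \<le> 0} = {}" using m by auto
      then have "i \<noteq> 0" using i False by (metis card.empty)
      then show ?thesis using i r by (intro bexI[of _ i]) (auto simp: c_def)
    qed
    show "partition_on {1..m} (arcs T)"
    proof (rule partition_onI)
      show "\<Union> (arcs T) = {1..m}" using assms by (auto simp: arcs_def c_def)
      show "{} \<notin> arcs T" unfolding arcs_def using surj by blast
    qed (auto simp: arcs_def disjnt_def)
    have "inj_on (\<lambda>r. {i \<in> {1..m}. c T i = r}) {..<l}"
      using surj by (intro inj_onI) blast
    then show "card (arcs T) = l" by (simp add: arcs_def card_image)
  qed
  ultimately have "card \<T> \<le> stirling2 m l"
    unfolding stirling2_def using finite_partitions by (intro card_inj_on_le)
  then show ?thesis using n_subsets[of "{1..m}" l] by (simp add: \<T>_def)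
qed

subsection \<open>Counting words\<close>

definition incr_lists :: "nat \<Rightarrow> nat \<Rightarrow> nat list set" where
  "incr_lists m k = {js. length js = m \<and> sorted_wrt (<) js \<and> set js \<subseteq> {..<k}}"

lemma finite_incr_lists: "finite (incr_lists m k)"
  by (rule finite_subset[OF _ finite_lists_length_eq[of "{..<k}" m]]) (auto simp: incr_lists_def)

lemma card_incr_lists_le: "card (incr_lists m k) \<le> k choose m"
proof -
  have "inj_on set (incr_lists m k)"
    by (rule inj_onI) (auto simp: incr_lists_def intro: strict_sorted_equal)
  moreover have "set ` incr_lists m k \<subseteq> {S. S \<subseteq> {..<k} \<and> card S = m}"
    by (auto simp: incr_lists_def strict_sorted_iff distinct_card)
  ultimately have "card (incr_lists m k) \<le> card {S. S \<subseteq> {..<k} \<and> card S = m}"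
    by (intro card_inj_on_le) auto
  then show ?thesis by (simp add: n_subsets)
qed

text \<open>The letter \<open>k\<close>, which no increasing list over \<open>{..<k}\<close> contains, stands for the frozen point.\<close>

definition collapsed_words :: "nat \<Rightarrow> nat \<Rightarrow> nat set \<Rightarrow> nat list set" where
  "collapsed_words m k J = map (\<lambda>i. if i \<in> J then i else k) ` incr_lists m k - {replicate m k}"

lemma card_collapsed_words_le: "card (collapsed_words m k J) \<le> k choose m"
proof -
  have "card (collapsed_words m k J) \<le> card (map (\<lambda>i. if i \<in> J then i else k) ` incr_lists m k)"
    unfolding collapsed_words_def by (intro card_mono finite_imageI finite_incr_lists) auto
  also have "\<dots> \<le> card (incr_lists m k)" by (rule card_image_le[OF finite_incr_lists])
  finally show ?thesis using card_incr_lists_le le_trans by blast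
qed

lemma eq_if_filter_eq:
  assumes "length u = length v" "filter (\<lambda>x. x \<noteq> k) u = filter (\<lambda>x. x \<noteq> k) v"
    "map (\<lambda>x. x \<noteq> k) u = map (\<lambda>x. x \<noteq> k) v"
  shows "u = v"
  using assms by (induction u v rule: list_induct2) (auto split: if_splits)

text \<open>A word with \<open>s\<close> letters other than \<open>k\<close> is determined by their
  positions and, as they increase, by their set. The constant word \<open>replicate m k\<close> was
  removed, so \<open>s\<close> starts at 1.\<close>

lemma card_collapsed_words_le_sum:
  assumes J: "J \<subseteq> {..<k}"
  shows "card (collapsed_words m k J) \<le> (\<Sum>s=1..m. (m choose s) * (card J choose s))"
proof -
  define pos where "pos w = {i. i < m \<and> w ! i \<noteq> k}" for w :: "nat list"
  have w: "length w = m" "sorted_wrt (<) (filter (\<lambda>x. x \<noteq> k) w)" "set w - {k} \<subseteq> J" "w \<noteq> replicate m k"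
    if mem: "w \<in> collapsed_words m k J" for w
  proof -
    obtain js where js: "js \<in> incr_lists m k" "w = map (\<lambda>i. if i \<in> J then i else k) js"
      using mem by (auto simp: collapsed_words_def)
    have "filter (\<lambda>x. x \<noteq> k) w = filter (\<lambda>i. i \<in> J) js"
      unfolding js(2) using J by (induction js) auto
    then show "sorted_wrt (<) (filter (\<lambda>x. x \<noteq> k) w)"
      using js by (simp add: incr_lists_def sorted_wrt_filter)
    show "length w = m" "set w - {k} \<subseteq> J" using js by (auto simp: incr_lists_def)
    show "w \<noteq> replicate m k" using mem by (simp add: collapsed_words_def)
  qed
  define X where "X = (SIGMA s:{1..m}. {T. T \<subseteq> {..<m} \<and> card T = s} \<times> {L. L \<subseteq> J \<and> card L = s})"
  define enc where "enc w = (card (pos w), pos w, set w - {k})" for w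
  have "finite J" using J finite_subset by blast
  have "inj_on enc (collapsed_words m k J)"
  proof (rule inj_onI)
    fix u v assume u: "u \<in> collapsed_words m k J" and v: "v \<in> collapsed_words m k J" and "enc u = enc v"
    then have e: "pos u = pos v" "set u - {k} = set v - {k}" by (auto simp: enc_def)
    show "u = v"
    proof (rule eq_if_filter_eq)
      show "length u = length v" using w(1)[OF u] w(1)[OF v] by simp
      show "filter (\<lambda>x. x \<noteq> k) u = filter (\<lambda>x. x \<noteq> k) v"
        using w(2)[OF u] w(2)[OF v] e(2) by (intro strict_sorted_equal) (auto simp: set_diff_eq)
      show "map (\<lambda>x. x \<noteq> k) u = map (\<lambda>x. x \<noteq> k) v"
      proof (rule nth_equalityI)
        fix i assume "i < length (map (\<lambda>x. x \<noteq> k) u)"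
        then have "i < m" using w(1)[OF u] by simp
        moreover have "i \<in> pos u \<longleftrightarrow> i \<in> pos v" using e(1) by simp
        ultimately show "map (\<lambda>x. x \<noteq> k) u ! i = map (\<lambda>x. x \<noteq> k) v ! i"
          using w(1)[OF u] w(1)[OF v] by (simp add: pos_def)
      qed (use w(1)[OF u] w(1)[OF v] in simp)
    qed
  qed
  moreover have "enc ` collapsed_words m k J \<subseteq> X"
  proof (rule image_subsetI)
    fix v assume v: "v \<in> collapsed_words m k J"
    have "card (set v - {k}) = length (filter (\<lambda>x. x \<noteq> k) v)"
      using w(2)[OF v] distinct_card[of "filter (\<lambda>x. x \<noteq> k) v"]
      by (simp add: strict_sorted_iff set_diff_eq)
    also have "\<dots> = card (pos v)"
      using w(1)[OF v] by (simp add: length_filter_conv_card pos_def)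
    finally have c: "card (set v - {k}) = card (pos v)" .
    have "pos v \<noteq> {}"
    proof
      assume "pos v = {}"
      then have "v = replicate m k" using w(1)[OF v] by (intro nth_equalityI) (auto simp: pos_def)
      with w(4)[OF v] show False by simp
    qed
    moreover have "pos v \<subseteq> {..<m}" by (auto simp: pos_def)
    ultimately have "card (pos v) \<in> {1..m}"
      using card_mono[of "{..<m}" "pos v"] finite_subset[of "pos v" "{..<m}"]
      by (simp add: Suc_le_eq card_gt_0_iff)
    then show "enc v \<in> X" using c w(3)[OF v] \<open>pos v \<subseteq> {..<m}\<close> by (simp add: enc_def X_def)
  qed
  moreover have "finite X" using \<open>finite J\<close> by (auto simp: X_def intro!: finite_SigmaI)
  ultimately have "card (collapsed_words m k J) \<le> card X" by (intro card_inj_on_le)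
  also have "card X = (\<Sum>s=1..m. (m choose s) * (card J choose s))"
    using \<open>finite J\<close> by (simp add: X_def card_SigmaI card_cartesian_product n_subsets)
  finally show ?thesis .
qed

section \<open>Comparison of the word count with the exponent\<close>

lemma real_choose_eq:
  assumes "0 < l" "0 < n"
  shows "real (n choose l) = real n * (1 / real l * real ((n - 1) choose (l - 1)))"
proof -
  have "real l * real (n choose l) = real n * real ((n - 1) choose (l - 1))"
    using times_binomial_minus1_eq[OF assms(1), of n] by (simp flip: of_nat_mult)
  then show ?thesis using assms by (simp add: field_simps)
qed

lemma one_le_stirling2:
  assumes "0 < l" "l \<le> m"
  shows "1 \<le> stirling2 m l"
proof (cases "l = 1")
  case True
  then show ?thesis using one_le_stirling2_1[of m] assms by simp
next
  case False
  then show ?thesis using choose_le_stirling2[of l m] assms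
    by (metis One_nat_def Suc_leI le_trans less_one linorder_not_le not_less_eq_eq numeral_2_eq_2
        le_antisym zero_less_binomial)
qed

lemma le_choose_two:
  assumes "2 \<le> m"
  shows "m - 1 \<le> m choose 2"
proof -
  have "2 * (m - 1) div 2 \<le> m * (m - 1) div 2" using assms by (intro div_le_mono mult_right_mono) auto
  then show ?thesis by (simp add: choose_two)
qed

text \<open>From \<open>s = 3\<close> on, terms compare one by one through
  \<open>choose_le_stirling2\<close>. Term 1 falls short by at most \<open>m - 1\<close>. Term 2
  makes up for it: \<open>j + 2 \<le> k\<close> leaves a surplus of at least
  \<open>stirling2 m 2\<close>, which is at least \<open>m choose 2\<close>, hence
  \<open>m - 1\<close>.\<close>

lemma sum_choose_le_stirling_sum:
  assumes "0 < j" "j + 2 \<le> k" "0 < m"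
  shows "(\<Sum>s=1..m. 1 / real s * real (m choose s) * real ((j - 1) choose (s - 1)))
    \<le> (\<Sum>l=1..m. 1 / real l * real ((k - 1) choose (l - 1)) * real (stirling2 m l))"
    (is "sum ?f _ \<le> sum ?g _")
proof (cases "m = 1")
  case True
  then show ?thesis using one_le_stirling2_1[of 1] by simp
next
  case False
  then have m: "2 \<le> m" using assms by simp
  have split: "sum h {1..m} = h 1 + h 2 + sum h {3..m}" for h :: "nat \<Rightarrow> real"
    using m by (simp add: sum.atLeast_Suc_atMost numeral_2_eq_2 numeral_3_eq_3)
  have "?f s \<le> ?g s" if "s \<in> {3..m}" for s
  proof -
    have "real (m choose s) * real ((j - 1) choose (s - 1)) \<le>
        real (stirling2 m s) * real ((k - 1) choose (s - 1))"
      using that assms choose_le_stirling2[of s m]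
      by (intro mult_mono of_nat_mono binomial_right_mono) auto
    then show ?thesis using that by (simp add: divide_right_mono mult_ac)
  qed
  then have rest: "sum ?f {3..m} \<le> sum ?g {3..m}" by (rule sum_mono)
  define S where "S = real (stirling2 m 2)"
  have "real (m choose 2) * real (j - 1) \<le> S * real (j - 1)"
    unfolding S_def using choose_le_stirling2[of 2 m] by (intro mult_right_mono) auto
  moreover have "S * (real (j - 1) + 2) \<le> S * real (k - 1)"
    unfolding S_def using assms by (intro mult_left_mono) auto
  moreover have "real m - 1 \<le> S"
    unfolding S_def using choose_le_stirling2[of 2 m] le_choose_two[OF m] by linarith
  moreover have "1 \<le> real (stirling2 m 1)" using one_le_stirling2_1[of m] m by simp
  ultimately have "?f 1 + ?f 2 \<le> ?g 1 + ?g 2"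
    by (simp add: S_def[symmetric] algebra_simps)
  then show ?thesis using rest unfolding split by linarith
qed

text \<open>With at most one frozen index, the bound \<open>k choose m\<close> is matched with the
  summand \<open>m\<close>, or with \<open>m\<close> and \<open>m - 1\<close>. With two or more, or
  for \<open>m = 1\<close>, the count by positions suffices.\<close>

lemma card_collapsed_words_le_gamma:
  assumes J: "J \<subseteq> {..<k}" "J \<noteq> {}" and m: "0 < m" "m \<le> k"
  shows "real (card (collapsed_words m k J)) \<le> real (card J) *
    (\<Sum>l=1..m. 1 / real l * real ((k - 1) choose (l - 1)) * real (stirling2 m l))"
    (is "_ \<le> _ * sum ?g _")
proof -
  define j where "j = card J"
  have j: "0 < j" "j \<le> k"
    using J card_mono[of "{..<k}" J] finite_subset[of J "{..<k}"] by (auto simp: j_def card_gt_0_iff)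
  have g: "1 / real l * real ((k - 1) choose (l - 1)) \<le> ?g l" if "l \<in> {1..m}" for l
    using one_le_stirling2[of l m] that by (simp add: mult_le_cancel_left1 divide_right_mono)
  consider "j = k" | "m = 1" | "j + 1 = k" "m \<noteq> 1" | "j + 2 \<le> k" using j by linarith
  then have "real (card (collapsed_words m k J)) \<le> real j * sum ?g {1..m}"
  proof cases
    case 1
    have "real (card (collapsed_words m k J)) \<le> real (k choose m)"
      using card_collapsed_words_le[of m k J] by simp
    also have "\<dots> = real k * (1 / real m * real ((k - 1) choose (m - 1)))"
      using real_choose_eq m by auto
    also have "\<dots> \<le> real k * ?g m" using g[of m] m by (intro mult_left_mono) auto
    also have "\<dots> \<le> real k * sum ?g {1..m}"
      using m by (intro mult_left_mono member_le_sum) auto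
    finally show ?thesis using 1 by simp
  next
    case 2
    have "real (card (collapsed_words m k J)) \<le> real j"
      using card_collapsed_words_le_sum[OF J(1), of m] 2 by (simp add: j_def)
    then show ?thesis using 2 j one_le_stirling2_1[of 1] 
      by (simp add: order_trans[OF _ mult_left_mono[of 1]])
  next
    case 3
    then have m2: "2 \<le> m" using m by simp
    have "real (card (collapsed_words m k J)) \<le> real (k choose m)"
      using card_collapsed_words_le[of m k J] by simp
    \<comment> \<open>Pascal's rule leaves binomials over \<open>j\<close>, which yield the factor
      \<open>card J\<close> instead of \<open>k\<close>.\<close>
    also have "k choose m = (j choose m) + (j choose (m - 1))"
      using 3 m2 choose_reduce_nat[of k m] by (simp flip: 3(1))
    also have "real \<dots> = real j * (1 / real m * real ((j - 1) choose (m - 1)) +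
        1 / real (m - 1) * real ((j - 1) choose (m - 1 - 1)))"
      using real_choose_eq[of m j] real_choose_eq[of "m - 1" j] m2 j by (simp add: distrib_left)
    also have "\<dots> \<le> real j * (1 / real m * real ((k - 1) choose (m - 1)) +
        1 / real (m - 1) * real ((k - 1) choose (m - 1 - 1)))"
      using j by (intro mult_left_mono add_mono of_nat_mono binomial_right_mono) auto
    also have "\<dots> \<le> real j * (?g m + ?g (m - 1))"
      using g[of m] g[of "m - 1"] m2 by (intro mult_left_mono add_mono) auto
    also have "?g m + ?g (m - 1) = sum ?g {m, m - 1}" using m2 by simp
    also have "real j * sum ?g {m, m - 1} \<le> real j * sum ?g {1..m}"
      using m2 by (intro mult_left_mono sum_mono2) auto
    finally show ?thesis .
  next
    case 4
    have "real (card (collapsed_words m k J)) \<le> (\<Sum>s=1..m. real (m choose s) * real (j choose s))"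
      using card_collapsed_words_le_sum[OF J(1), of m] unfolding j_def
      by (simp flip: of_nat_mult of_nat_sum)
    also have "\<dots> = real j * (\<Sum>s=1..m. 1 / real s * real (m choose s) * real ((j - 1) choose (s - 1)))"
      unfolding sum_distrib_left using j by (intro sum.cong) (auto simp: real_choose_eq)
    also have "\<dots> \<le> real j * sum ?g {1..m}"
      using sum_choose_le_stirling_sum[OF j(1) 4 m(1)] by (intro mult_left_mono) auto
    finally show ?thesis .
  qed
  then show ?thesis by (simp add: j_def)
qed

subsection \<open>Locating distinct tuples\<close>

text \<open>Fermat: multiplication by \<open>x\<close> permutes the nonzero elements, so this power
  fixes their nonzero product.\<close>

lemma power_card_minus_one_eq_1:
  fixes x :: "'a::{field,finite}"
  assumes "x \<noteq> 0"
  shows "x ^ (card (UNIV :: 'a set) - 1) = 1"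
proof -
  let ?U = "UNIV - {0 :: 'a}"
  have "(\<Prod>y\<in>?U. x * y) = (\<Prod>y\<in>?U. y)"
    by (rule prod.reindex_bij_witness[of _ "\<lambda>y. y / x" "\<lambda>y. x * y"]) (use assms in auto)
  then have "x ^ card ?U * (\<Prod>y\<in>?U. y) = 1 * (\<Prod>y\<in>?U. y)" by (simp add: prod.distrib)
  moreover have "(\<Prod>y\<in>?U. y) \<noteq> 0" by simp
  ultimately show ?thesis by (simp add: card_Diff_singleton)
qed

text \<open>Source of the degree saving: index lists that collapse to the same word contribute one
  0-1-valued factor instead of several.\<close>

lemma prod_image_idem:
  fixes f :: "'b \<Rightarrow> 'a::comm_monoid_mult"
  assumes "finite S" "\<And>s. s \<in> S \<Longrightarrow> f (r s) * f (r s) = f (r s)"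
  shows "(\<Prod>s\<in>S. f (r s)) = (\<Prod>w\<in>r ` S. f w)"
  using assms
proof (induction S)
  case (insert s S)
  show ?case
  proof (cases "r s \<in> r ` S")
    case True
    have "(\<Prod>w\<in>r ` S. f w) = f (r s) * (\<Prod>w\<in>r ` S - {r s}. f w)"
      using insert.hyps True by (intro prod.remove) auto
    then have "f (r s) * (\<Prod>w\<in>r ` S. f w) = (\<Prod>w\<in>r ` S. f w)"
      using insert.prems[of s] by (simp flip: mult.assoc)
    then show ?thesis using insert True by (simp add: insert_absorb)
  qed (use insert in auto)
qed simp

text \<open>Hypothesis \<open>t\<close> is the degree bound for the term of \<open>J\<close>: each
  collapsed word gives a factor of degree at most \<open>N * total_degree Q\<close>.\<close>

lemma card_le_if_no_distinct_tuple:
  fixes A :: "'a::{field,finite} vec set"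
  defines "N \<equiv> card (UNIV :: 'a set) - 1"
  assumes id: "is_identifier k m n P g Q" and m: "0 < m" "m \<le> k"
    and A: "A \<subseteq> carrier_vec n"
    and none: "\<not> (\<exists>xs. length xs = k \<and> distinct xs \<and> set xs \<subseteq> A \<and> P xs)"
    and t: "\<And>J. J \<subseteq> {..<k} \<Longrightarrow> J \<noteq> {} \<Longrightarrow>
      card (collapsed_words m k J) * (N * total_degree Q) < card J * (t + 1)"
  shows "card A \<le> k * (n + 1) ^ t"
proof (rule ccontr)
  assume "\<not> ?thesis"
  then have big: "k * (n + 1) ^ t < card A" by simp
  then have fin: "finite A" by (metis card.infinite not_less_zero)
  have "card {0, 1 :: 'a} \<le> card (UNIV :: 'a set)" by (intro card_mono) auto
  then have "0 < N" by (simp add: N_def)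
  have vars: "mpoly_vars Q \<subseteq> {..<m} \<times> {..<n}"
    and g_eval: "\<And>xs. xs \<in> vec_tuples m n \<Longrightarrow> g xs = mpoly_eval Q (\<lambda>(i, j). (xs ! i) $ j)"
    and P_iff: "\<And>xs. xs \<in> vec_tuples k n \<Longrightarrow>
        P xs \<longleftrightarrow> (\<forall>js\<in>incr_lists m k. g (map (\<lambda>i. xs ! i) js) = 0)"
    and g_diag: "\<And>x. x \<in> carrier_vec n \<Longrightarrow> g (replicate m x) = 0"
    using id unfolding is_identifier_def incr_lists_def by blast+

  define \<Phi> :: "('a vec \<Rightarrow> 'a) set"
    where "\<Phi> = (\<lambda>ls y. \<Prod>l\<leftarrow>ls. y $ l) ` {ls. set ls \<subseteq> {..<n} \<and> length ls \<le> t}"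
  have "finite \<Phi>" "card \<Phi> \<le> (n + 1) ^ t"
    unfolding \<Phi>_def by (rule card_monomials_le)+
  then have "k * card \<Phi> < card A" using big by (meson le_less_trans mult_le_mono2)
  from exists_orthogonal_functions_meeting_in_point[OF \<open>finite \<Phi>\<close> fin this]
  obtain a h where a: "a \<in> A"
    and h: "\<forall>i<k. h i a = 1 \<and> (\<forall>x. h i x \<noteq> 0 \<longrightarrow> x \<in> A) \<and> (\<forall>\<phi>\<in>\<Phi>. (\<Sum>x\<in>A. h i x * \<phi> x) = 0)"
    and meet: "\<forall>i<k. \<forall>j<k. \<forall>x. i \<noteq> j \<and> h i x \<noteq> 0 \<and> h j x \<noteq> 0 \<longrightarrow> x = a"
    by (elim bexE exE conjE)
  have a_carrier: "a \<in> carrier_vec n" using a A by blast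

  define f where "f xs = 1 - g xs ^ N" for xs
  define F where "F x = (\<Prod>js\<in>incr_lists m k. f (map x js))" for x
  \<comment> \<open>The minus sign is part of \<open>\<delta>\<close>, so
    \<open>h i + \<delta>\<close> vanishes at \<open>a\<close>.\<close>
  define \<delta> where "\<delta> y = (if y = a then - 1 else 0 :: 'a)" for y
  define X where "X = PiE {..<k} (\<lambda>_. A)"
  have "finite X" unfolding X_def using fin by (intro finite_PiE) auto
  have f_01: "f xs = (if g xs = 0 then 1 else 0)" for xs
    using power_card_minus_one_eq_1[of "g xs"] \<open>0 < N\<close> by (simp add: f_def N_def)

  have "F x * (\<Prod>i<k. h i (x i) + \<delta> (x i)) = 0" if x: "x \<in> X" for x
  proof (rule ccontr)
    assume nz: "F x * (\<Prod>i<k. h i (x i) + \<delta> (x i)) \<noteq> 0"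
    \<comment> \<open>A nonzero weight puts each \<open>x i\<close> into the support of
      \<open>h i\<close> and away from \<open>a\<close>, so the entries are distinct. By
      \<open>none\<close>, some factor of \<open>F x\<close> is then 0.\<close>
    then have "h i (x i) \<noteq> 0 \<and> x i \<noteq> a" if "i < k" for i
      using that h by (auto simp: \<delta>_def split: if_splits)
    then have inj: "inj_on x {..<k}"
      using meet by (intro inj_onI) (metis lessThan_iff)
    define xs where "xs = map x [0..<k]"
    have xs: "length xs = k" "distinct xs" "set xs \<subseteq> A"
      using inj x by (auto simp: xs_def X_def distinct_map lessThan_atLeast0)
    then have "\<not> P xs" "xs \<in> vec_tuples k n" using none A by (auto simp: vec_tuples_def)
    then obtain js where js: "js \<in> incr_lists m k" "g (map (\<lambda>i. xs ! i) js) \<noteq> 0"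
      using P_iff by blast
    have "map (\<lambda>i. xs ! i) js = map x js"
      using js(1) by (auto simp: xs_def incr_lists_def subset_iff)
    with js(2) have "g (map x js) \<noteq> 0" by argo
    then have "f (map x js) = 0" by (simp add: f_01)
    then have "F x = 0" unfolding F_def using js finite_incr_lists by (intro prod_zero) auto
    then show False using nz by simp
  qed
  then have "0 = (\<Sum>x\<in>X. F x * (\<Prod>i<k. h i (x i) + \<delta> (x i)))"
    by (intro sum.neutral[symmetric]) blast
  also have "\<dots> = (\<Sum>J\<in>Pow {..<k}. \<Sum>x\<in>X. F x * ((\<Prod>i\<in>J. h i (x i)) * (\<Prod>i\<in>{..<k} - J. \<delta> (x i))))"
    unfolding prod_add[OF finite_lessThan] sum_distrib_left by (rule sum.swap)
  also have "\<dots> = (\<Sum>J\<in>{{}}. \<Sum>x\<in>X. F x * ((\<Prod>i\<in>J. h i (x i)) * (\<Prod>i\<in>{..<k} - J. \<delta> (x i))))"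
  proof (rule sum.mono_neutral_right)
    show "\<forall>J\<in>Pow {..<k} - {{}}.
        (\<Sum>x\<in>X. F x * ((\<Prod>i\<in>J. h i (x i)) * (\<Prod>i\<in>{..<k} - J. \<delta> (x i)))) = 0"
    proof
      fix J assume "J \<in> Pow {..<k} - {{}}"
      then have J: "J \<subseteq> {..<k}" "J \<noteq> {}" by auto
      define W where "W = collapsed_words m k J"
      have W: "length w = m" "set w \<subseteq> insert k J" if "w \<in> W" for w
        using that by (auto simp: W_def collapsed_words_def incr_lists_def)
      define u where "u i = (if i \<in> J then h i else \<delta>)" for i
      \<comment> \<open>Letter \<open>k\<close> becomes the matching coordinate of \<open>a\<close>,
        other letters remain variables. So \<open>G\<close> involves only the \<open>x i\<close>
        with \<open>i \<in> J\<close>.\<close>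
      define \<sigma> where "\<sigma> w v z = (if w ! fst v = k then a $ snd v else z (w ! fst v, snd v))"
        for w :: "nat list" and v :: "nat \<times> nat" and z :: "nat \<times> nat \<Rightarrow> 'a"
      define G where "G z = (\<Prod>w\<in>W. 1 - mpoly_eval Q (\<lambda>v. \<sigma> w v z) ^ N)" for z
      have u: "(\<Prod>i\<in>J. h i (x i)) * (\<Prod>i\<in>{..<k} - J. \<delta> (x i)) = (\<Prod>i<k. u i (x i))" for x
        unfolding prod.subset_diff[OF J(1) finite_lessThan] mult.commute[of "prod _ J"]
        by (intro arg_cong2[of _ _ _ _ "(*)"] prod.cong) (auto simp: u_def)
      have "poly_fun_le (J \<times> {..<n}) (\<Sum>w\<in>W. N * total_degree Q) G"
        unfolding G_def
      proof (intro poly_fun_le_prod poly_fun_le_one_minus poly_fun_le_power poly_fun_le_mpoly_eval)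
        fix w v assume "w \<in> W" "v \<in> mpoly_vars Q"
        then have v: "fst v < length w" "snd v \<in> {..<n}" and "set w \<subseteq> insert k J"
          using W[of w] vars by auto
        then have "w ! fst v \<in> insert k J" using nth_mem by blast
        then show "poly_fun_le (J \<times> {..<n}) 1 (\<sigma> w v)"
          using v unfolding \<sigma>_def by (cases "w ! fst v = k") (auto intro: poly_fun_le_const poly_fun_le_var)
      qed
      then have G: "poly_fun_le (J \<times> {..<n}) (card W * (N * total_degree Q)) G" by simp
      have zero: "(\<Sum>x\<in>X. G (\<lambda>v. x (fst v) $ snd v) * (\<Prod>i<k. u i (x i))) = 0"
        unfolding X_def
      proof (rule sum_PiE_poly_fun_eq_0[where \<xi> = vec_index, OF finite_lessThan J(1) fin _ G])
        fix i ls assume "i \<in> J" "set ls \<subseteq> {..<n}" "length ls \<le> t"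
        then show "(\<Sum>y\<in>A. u i y * (\<Prod>l\<leftarrow>ls. y $ l)) = 0"
          using h J unfolding u_def \<Phi>_def by auto
      qed (use t[OF J] in \<open>simp add: W_def\<close>)
      \<comment> \<open>\<open>F\<close> and \<open>G\<close> agree on tuples equal to
        \<open>a\<close> outside \<open>J\<close>; on all others a factor \<open>\<delta>\<close>
        makes both sides 0.\<close>
      have "F x * (\<Prod>i<k. u i (x i)) = G (\<lambda>v. x (fst v) $ snd v) * (\<Prod>i<k. u i (x i))"
        if x: "x \<in> X" for x
      proof (cases "\<forall>i\<in>{..<k} - J. x i = a")
        case True
        define x' where "x' = x(k := a)"
        define r where "r = map (\<lambda>i. if i \<in> J then i else k)"
        have x'_A: "x' i \<in> A" if "i \<in> insert k J" for i
          using that x a J by (auto simp: x'_def X_def)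
        have "map x js = map x' (r js)" if "js \<in> incr_lists m k" for js
          using that True J by (auto simp: r_def x'_def incr_lists_def subset_iff)
        then have "F x = (\<Prod>js\<in>incr_lists m k. f (map x' (r js)))"
          unfolding F_def by (intro prod.cong) auto
        also have "\<dots> = (\<Prod>w\<in>r ` incr_lists m k. f (map x' w))"
          by (rule prod_image_idem[where f = "\<lambda>w. f (map x' w)", OF finite_incr_lists]) (simp add: f_01)
        \<comment> \<open>Only \<open>replicate m k\<close> can be lost; its factor is 1 because
          \<open>g\<close> vanishes on constant tuples.\<close>
        also have "\<dots> = (\<Prod>w\<in>W. f (map x' w))"
        proof (rule prod.mono_neutral_right)
          show "\<forall>w\<in>r ` incr_lists m k - W. f (map x' w) = 1"
            using g_diag[OF a_carrier]
            by (auto simp: W_def collapsed_words_def r_def[symmetric] f_01 x'_def)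
        qed (auto simp: W_def collapsed_words_def r_def finite_incr_lists)
        also have "\<dots> = G (\<lambda>v. x (fst v) $ snd v)"
          unfolding G_def
        proof (intro prod.cong refl)
          fix w assume w: "w \<in> W"
          have "map x' w \<in> vec_tuples m n"
            using W[OF w] x'_A A by (auto simp: vec_tuples_def)
          then have "g (map x' w) = mpoly_eval Q (\<lambda>(i, j). (map x' w ! i) $ j)" by (rule g_eval)
          also have "\<dots> = mpoly_eval Q (\<lambda>v. \<sigma> w v (\<lambda>v. x (fst v) $ snd v))"
            using vars W(1)[OF w] by (intro mpoly_eval_cong) (auto simp: \<sigma>_def x'_def)
          finally show "f (map x' w) = 1 - mpoly_eval Q (\<lambda>v. \<sigma> w v (\<lambda>v. x (fst v) $ snd v)) ^ N"
            by (simp add: f_def)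
        qed
        finally show ?thesis by simp
      next
        case False
        then have "(\<Prod>i<k. u i (x i)) = 0"
          by (intro prod_zero) (auto simp: u_def \<delta>_def)
        then show ?thesis by simp
      qed
      then show "(\<Sum>x\<in>X. F x * ((\<Prod>i\<in>J. h i (x i)) * (\<Prod>i\<in>{..<k} - J. \<delta> (x i)))) = 0"
        unfolding u zero[symmetric] by (rule sum.cong[OF refl])
    qed
  qed auto
  also have "\<dots> = (\<Sum>x\<in>X. F x * (\<Prod>i<k. \<delta> (x i)))" by simp
  \<comment> \<open>Only the constant tuple has nonzero weight; its restriction to
    \<open>{..<k}\<close> makes it an element of the extensional space \<open>X\<close>.\<close>
  also have "\<dots> = (\<Sum>x\<in>{\<lambda>i\<in>{..<k}. a}. F x * (\<Prod>i<k. \<delta> (x i)))"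
  proof (rule sum.mono_neutral_right[OF \<open>finite X\<close>])
    show "{\<lambda>i\<in>{..<k}. a} \<subseteq> X" using a by (auto simp: X_def)
    show "\<forall>x\<in>X - {\<lambda>i\<in>{..<k}. a}. F x * (\<Prod>i<k. \<delta> (x i)) = 0"
    proof
      fix x assume x: "x \<in> X - {\<lambda>i\<in>{..<k}. a}"
      then have "\<exists>i<k. x i \<noteq> a" by (auto simp: X_def PiE_def extensional_def fun_eq_iff restrict_def)
      then have "(\<Prod>i<k. \<delta> (x i)) = 0" by (intro prod_zero) (auto simp: \<delta>_def)
      then show "F x * (\<Prod>i<k. \<delta> (x i)) = 0" by simp
    qed
  qed
  \<comment> \<open>\<open>F\<close> is 1 at the constant tuple and each \<open>\<delta>\<close> is
    -1; this nonzero value contradicts the vanishing of the sum.\<close>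
  also have "\<dots> = (- 1) ^ k"
  proof -
    have "map (\<lambda>i\<in>{..<k}. a) js = replicate m a" if "js \<in> incr_lists m k" for js
      using that by (auto simp: incr_lists_def subset_iff intro!: nth_equalityI)
    then have "F (\<lambda>i\<in>{..<k}. a) = 1"
      unfolding F_def using g_diag[OF a_carrier] by (intro prod.neutral) (simp add: f_01)
    then show ?thesis by (simp add: \<delta>_def)
  qed
  finally show False by simp
qed

theorem mainTheorem6:
  fixes k m d p e q :: nat and \<gamma> :: real
  assumes "0 < k" and "0 < m" and "m \<le> k" and "0 < d"
    and "prime p" and "k \<le> p" and "0 < e" and "q = p ^ e"
    and "card (UNIV :: 'a::{field,finite} set) = q"
    and "\<gamma> = (\<Sum>l=1..m. 1 / real l * real ((k - 1) choose (l - 1)) * real (stirling2 m l))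
              * real d * real (q - 1)"
  shows "\<exists>C::real. \<forall>n\<ge>1. \<forall>(P :: 'a vec list \<Rightarrow> bool) g Q A.
           is_identifier k m n P g Q \<and> total_degree Q = d \<and>
           A \<subseteq> carrier_vec n \<and>
           \<not> (\<exists>xs. length xs = k \<and> distinct xs \<and> set xs \<subseteq> A \<and> P xs)
           \<longrightarrow> real (card A) \<le> C * real n powr \<gamma>"
proof -
  \<comment> \<open>The integer part serves twice: \<open>t \<le> \<gamma>\<close> bounds the size
    of \<open>A\<close>, and \<open>\<gamma> < t + 1\<close> makes the degree inequality
    strict.\<close>
  define t where "t = nat \<lfloor>\<gamma>\<rfloor>"
  have "0 \<le> \<gamma>" unfolding assms(10) by (intro mult_nonneg_nonneg sum_nonneg) auto
  then have t: "real t \<le> \<gamma>" "\<gamma> < real (t + 1)" unfolding t_def by linarith+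
  have deg: "card (collapsed_words m k J) * ((q - 1) * d) < card J * (t + 1)"
    if J: "J \<subseteq> {..<k}" "J \<noteq> {}" for J
  proof -
    have "real (card (collapsed_words m k J)) * (real d * real (q - 1)) \<le> (real (card J) *
        (\<Sum>l=1..m. 1 / real l * real ((k - 1) choose (l - 1)) * real (stirling2 m l))) * (real d * real (q - 1))"
      by (intro mult_right_mono card_collapsed_words_le_gamma J assms) auto
    also have "\<dots> = real (card J) * \<gamma>" unfolding assms(10) by (simp only: mult.assoc)
    also have "\<dots> < real (card J) * real (t + 1)"
      using t J finite_subset[of J "{..<k}"] by (intro mult_strict_left_mono) (auto simp: card_gt_0_iff)
    finally have "real (card (collapsed_words m k J) * ((q - 1) * d)) < real (card J * (t + 1))"
      by (simp only: of_nat_mult mult_ac)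
    then show ?thesis by (simp only: of_nat_less_iff)
  qed
  show ?thesis
  \<comment> \<open>The factor \<open>2 ^ t\<close> comes from
    \<open>n + 1 \<le> 2 * n\<close>.\<close>
  proof (intro exI[of _ "real k * 2 ^ t"] allI impI)
    fix n P and g :: "'a vec list \<Rightarrow> 'a" and Q A
    assume n: "1 \<le> (n::nat)"
      and "is_identifier k m n P g Q \<and> total_degree Q = d \<and> A \<subseteq> carrier_vec n \<and>
        \<not> (\<exists>xs. length xs = k \<and> distinct xs \<and> set xs \<subseteq> A \<and> P xs)"
    then have "card A \<le> k * (n + 1) ^ t"
      using deg assms by (intro card_le_if_no_distinct_tuple[where P = P and g = g and Q = Q]) auto
    also have "\<dots> \<le> k * (2 * n) ^ t" using n by (intro mult_left_mono power_mono) auto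
    finally have "real (card A) \<le> real (k * (2 * n) ^ t)" by (simp only: of_nat_le_iff)
    also have "\<dots> = real k * 2 ^ t * real n powr real t"
      using n by (simp add: power_mult_distrib powr_realpow)
    also have "\<dots> \<le> real k * 2 ^ t * real n powr \<gamma>"
      using n t by (intro mult_left_mono powr_mono) auto
    finally show "real (card A) \<le> real k * 2 ^ t * real n powr \<gamma>" .
  qed
qed

end
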